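(* For every $(p,q)\in(\mathbb{N}^* )^2$ and every fixed $n\in\mathbb{N}$, the sequence $\left(v_{p,q,m}^{(n)}\right)_{m\in\mathbb{N}}$ defined by $v_{p,q,m}^{(n)}=S_{p,q}^{(n)}+(-1)^{n+1}\rho_{p,q,m}^{(n)}$ converges infra-linearly (as $m\to+\infty$) to $S_{p,q}$, but faster than the sequence of partial sums $\left(S_{p,q}^{(m)}\right)_{m\in\mathbb{N}}$; moreover there exists a real $\omega>0$ (depending on $p,q,n$ but not on $m$) such that $$\left|v_{p,q,m}^{(n)}-S_{p,q}\right|=\left|\rho_{p,q,m}^{(n)}-R_{p,q}^{(n)}\right|\underset{m\to+\infty}{\sim}\frac{\omega}{m^{2n+1+\frac{2q}{p}}}.$$
   Context: $\mathbb{N}^*$ denotes the positive integers and $\mathbb{N}$ the nonnegative integers. For $(p,q)\in(\mathbb{N}^* )^2$ and $n\in\mathbb{N}$, put $S_{p,q}=\sum_{k=0}^{+\infty}\frac{(-1)^k}{pk+q}$, $S_{p,q}^{(n)}=\sum_{k=0}^{n}\frac{(-1)^k}{pk+q}$, and $\alpha_{p,q}^{(n)}=2pn+p+2q$. For $m\in\mathbb{N}$, $\rho_{p,q,m}^{(n)}$ is the finite generalized continued fraction $$\rho_{p,q,m}^{(n)}=\cfrac{1}{\alpha+\cfrac{(1p)^2}{\alpha+\cfrac{(2p)^2}{\alpha+\cdots+\cfrac{(mp)^2}{\alpha}}}},\qquad \alpha=\alpha_{p,q}^{(n)},$$ with $\rho_{p,q,0}^{(n)}=1/\alpha_{p,q}^{(n)}$.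 The quantity $R_{p,q}^{(n)}$ is determined by $S_{p,q}=S_{p,q}^{(n)}+(-1)^{n+1}R_{p,q}^{(n)}$; by a previously known theorem it equals $\lim_{m\to+\infty}\rho_{p,q,m}^{(n)}$, the value of the corresponding infinite continued fraction. A real sequence $(u_m)$ converging to $\ell$ converges infra-linearly if $\left|\frac{u_{m+1}-\ell}{u_m-\ell}\right|$ is defined and converges to $1$. If $(v_m)$ also converges to $\ell$, then $(v_m)$ converges faster than $(u_m)$ if $\left|\frac{v_m-\ell}{u_m-\ell}\right|\to 0$. The notation $a_m\sim b_m$ means $a_m/b_m\to1$. *)

theory Defs
  imports "HOL-Analysis.Analysis" "HOL-Library.Landau_Symbols"
begin

definition S_inf :: "nat \<Rightarrow> nat \<Rightarrow> real" where
  "S_inf p q = (\<Sum>k. (-1) ^ k / (real p * real k + real q))"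

definition S_part :: "nat \<Rightarrow> nat \<Rightarrow> nat \<Rightarrow> real" where
  "S_part p q n = (\<Sum>k=0..n. (-1) ^ k / (real p * real k + real q))"

definition alpha :: "nat \<Rightarrow> nat \<Rightarrow> nat \<Rightarrow> real" where
  "alpha p q n = 2 * real p * real n + real p + 2 * real q"

text \<open>The partial numerators \<open>(1p)\<^sup>2, \<dots>, (mp)\<^sup>2\<close> are folded in from the innermost
  denominator outwards, so \<open>k = 1\<close> is the outermost level; for \<open>m = 0\<close> the list is empty.\<close>

definition rho :: "nat \<Rightarrow> nat \<Rightarrow> nat \<Rightarrow> nat \<Rightarrow> real" where
  "rho p q n m =
     1 / foldr (\<lambda>k t. alpha p q n + (real k * real p)\<^sup>2 / t) [1..<Suc m] (alpha p q n)"

text \<open>The remainder is the solution \<open>R\<close> of \<open>S = S\<^sub>n + (-1)\<^bsup>n+1\<^esup> R\<close>; see \<open>S_inf_eq\<close> below.\<close>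

definition R_rem :: "nat \<Rightarrow> nat \<Rightarrow> nat \<Rightarrow> real" where
  "R_rem p q n = (-1) ^ (n + 1) * (S_inf p q - S_part p q n)"

lemma S_inf_eq: "S_inf p q = S_part p q n + (-1) ^ (n + 1) * R_rem p q n"
  by (simp add: R_rem_def flip: mult.assoc power_add)

definition v_seq :: "nat \<Rightarrow> nat \<Rightarrow> nat \<Rightarrow> nat \<Rightarrow> real" where
  "v_seq p q n m = S_part p q n + (-1) ^ (n + 1) * rho p q n m"

text \<open>Since \<open>x / 0 = 0\<close> here, that the quotients are defined is required explicitly in the
  two notions below.\<close>

definition converges_infra_linearly :: "(nat \<Rightarrow> real) \<Rightarrow> real \<Rightarrow> bool" where
  "converges_infra_linearly u l \<longleftrightarrow>
     u \<longlonglongrightarrow> l \<and> (\<forall>m. u m \<noteq> l) \<and>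
     (\<lambda>m. \<bar>(u (Suc m) - l) / (u m - l)\<bar>) \<longlonglongrightarrow> 1"

text \<open>\<open>converges_faster v u l\<close>: \<open>v\<close> converges to \<open>l\<close> faster than \<open>u\<close>.\<close>

definition converges_faster :: "(nat \<Rightarrow> real) \<Rightarrow> (nat \<Rightarrow> real) \<Rightarrow> real \<Rightarrow> bool" where
  "converges_faster v u l \<longleftrightarrow>
     u \<longlonglongrightarrow> l \<and> v \<longlonglongrightarrow> l \<and> (\<forall>m. u m \<noteq> l) \<and>
     (\<lambda>m. \<bar>(v m - l) / (u m - l)\<bar>) \<longlonglongrightarrow> 0"

end

theory Submission
  imports Defs "HOL-Real_Asymp.Real_Asymp"
begin

text \<open>Put \<open>c = n + q / p\<close> and \<open>I\<^sub>m = \<integral>\<^sub>0\<^sup>1 t\<^sup>m (1 - t)\<^sup>c (1 + t)\<^bsup>-c-1\<^esup> dt\<close>. Integrating the derivative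
  of \<open>t\<^sup>m (1 - t)\<^bsup>c+1\<^esup> (1 + t)\<^bsup>-c\<^esup>\<close> shows that \<open>(-1)\<^sup>m I\<^sub>m\<close> is the minimal solution of
  \<open>(m + 1) x\<^bsub>m+1\<^esub> = (2c + 1) x\<^sub>m + m x\<^bsub>m-1\<^esub>\<close>, the three-term recurrence of the continued fraction
  divided by \<open>p\<close>, and \<open>I\<^sub>0 = p R\<close>. If \<open>b\<^sub>m\<close> is the solution with \<open>b\<^sub>0 = 1\<close>, \<open>b\<^sub>1 = 2c + 1\<close>, then
  \<open>\<rho>\<^sub>m - R = (-1)\<^sup>m I\<^bsub>m+1\<^esub> / (p b\<^bsub>m+1\<^esub>)\<close> exactly. Comparison with a Beta integral gives
  \<open>I\<^sub>m \<sim> 2\<^bsup>-c-1\<^esup> \<Gamma>(c + 1) / m\<^bsup>c+1\<^esup>\<close>, and the Casoratian identity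
  \<open>(m + 1) (b\<^bsub>m+1\<^esub> I\<^sub>m + b\<^sub>m I\<^bsub>m+1\<^esub>) = 1\<close> turns this into \<open>b\<^sub>m I\<^sub>m \<sim> 1 / (2m)\<close>, hence into the
  asymptotics of the error, with exponent \<open>2c + 1\<close>.\<close>

section \<open>Moments of the weight: integral identities and positivity\<close>

definition cf_weight :: "real \<Rightarrow> real \<Rightarrow> real" where
  "cf_weight c t = (1 - t) powr c * (1 + t) powr (- c - 1)"

definition cf_moment :: "real \<Rightarrow> nat \<Rightarrow> real" where
  "cf_moment c m = integral {0..1} (\<lambda>t. t ^ m * cf_weight c t)"

lemma cf_weight_nonneg: "cf_weight c t \<ge> 0"
  by (simp add: cf_weight_def)

lemma continuous_on_cf_weight:
  assumes "c > 0"
  shows "continuous_on {0..1} (cf_weight c)"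
  unfolding cf_weight_def using assms
  by (intro continuous_intros continuous_on_powr') auto

lemma cf_moment_has_integral:
  assumes "c > 0"
  shows "((\<lambda>t. t ^ m * cf_weight c t) has_integral cf_moment c m) {0..1}"
  unfolding cf_moment_def
  by (intro integrable_integral integrable_continuous_interval continuous_intros
      continuous_on_cf_weight assms)

text \<open>The differentiated function is \<open>(1 - t\<^sup>2) * cf_weight c t\<close>, with
  value 1 at \<open>t = 0\<close> and 0 at \<open>t = 1\<close>. Multiplying it by a power of
  \<open>t\<close> and integrating the derivative gives relations between moments.\<close>

lemma has_real_derivative_cf_weight:
  assumes "0 < t" "t < 1"
  shows "((\<lambda>t. (1 - t) powr (c + 1) * (1 + t) powr (- c)) has_real_derivative
    - (2 * c + 1 + t) * cf_weight c t) (at t)"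
proof -
  have e: "(1 - t) powr (c + 1) = (1 - t) powr c * (1 - t)"
    "(1 + t) powr (- c) = (1 + t) powr (- c - 1) * (1 + t)"
    using assms by (simp_all add: powr_diff powr_add)
  show ?thesis
    unfolding cf_weight_def
    using assms by (auto intro!: derivative_eq_intros simp: e) (simp add: algebra_simps)
qed

text \<open>No power of \<open>t\<close> is present, so the boundary value 1 at \<open>t = 0\<close>
  survives. This normalises the moments and starts the induction for the Casoratian.\<close>

lemma cf_moment_0_1:
  assumes "c > 0"
  shows "(2 * c + 1) * cf_moment c 0 + cf_moment c 1 = 1"
proof -
  define H where "H = (\<lambda>t::real. (1 - t) powr (c + 1) * (1 + t) powr (- c))"
  have "((\<lambda>t. - (2 * c + 1 + t) * cf_weight c t) has_integral (H 1 - H 0)) {0..1}"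
    unfolding H_def using has_real_derivative_cf_weight assms
    by (intro fundamental_theorem_of_calculus_interior continuous_intros continuous_on_powr')
      (auto simp: has_real_derivative_iff_has_vector_derivative[symmetric])
  moreover have "((\<lambda>t. - (2 * c + 1 + t) * cf_weight c t) has_integral
      (- ((2 * c + 1) * cf_moment c 0 + cf_moment c 1))) {0..1}"
  proof -
    have "((\<lambda>t. - ((2 * c + 1) * (t ^ 0 * cf_weight c t) + t ^ 1 * cf_weight c t)) has_integral
      (- ((2 * c + 1) * cf_moment c 0 + cf_moment c 1))) {0..1}"
      by (intro has_integral_neg has_integral_add has_integral_mult_right
          cf_moment_has_integral assms)
    also have "(\<lambda>t. - ((2 * c + 1) * (t ^ 0 * cf_weight c t) + t ^ 1 * cf_weight c t)) =
        (\<lambda>t. - (2 * c + 1 + t) * cf_weight c t)"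
      by (intro ext) (simp add: algebra_simps)
    finally show ?thesis .
  qed
  ultimately have "H 1 - H 0 = - ((2 * c + 1) * cf_moment c 0 + cf_moment c 1)"
    by (rule has_integral_unique)
  then show ?thesis by (simp add: H_def)
qed

text \<open>The primitive carries the factor \<open>t ^ (m + 1)\<close> and vanishes at both
  ends.\<close>

lemma cf_moment_rec:
  assumes "c > 0"
  shows "real (m + 1) * cf_moment c m =
    (2 * c + 1) * cf_moment c (m + 1) + real (m + 2) * cf_moment c (m + 2)"
proof -
  define H where "H = (\<lambda>t::real. t ^ (m + 1) * ((1 - t) powr (c + 1) * (1 + t) powr (- c)))"
  define D where "D = (\<lambda>t::real. real (m + 1) * (t ^ m * cf_weight c t)
      - (2 * c + 1) * (t ^ (m + 1) * cf_weight c t) - real (m + 2) * (t ^ (m + 2) * cf_weight c t))"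
  have D: "(H has_real_derivative D t) (at t)" if t: "0 < t" "t < 1" for t
  proof -
    have e: "(1 - t) powr (c + 1) * (1 + t) powr (- c) = cf_weight c t * (1 - t\<^sup>2)"
    proof -
      have "(1 + t) powr (- c) = (1 + t) powr (- c - 1) * (1 + t)"
        using t by (simp add: powr_diff)
      moreover have "(1 - t) powr (c + 1) = (1 - t) powr c * (1 - t)"
        using t by (simp add: powr_add)
      ultimately show ?thesis
        by (simp only: cf_weight_def power2_eq_square) (simp add: algebra_simps)
    qed
    have "(H has_real_derivative real (m + 1) * t ^ m * (cf_weight c t * (1 - t\<^sup>2))
      + t ^ (m + 1) * (- (2 * c + 1 + t) * cf_weight c t)) (at t)"
      unfolding H_def by (rule derivative_eq_intros has_real_derivative_cf_weight refl t)+ (simp add: e)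
    also have "real (m + 1) * t ^ m * (cf_weight c t * (1 - t\<^sup>2))
      + t ^ (m + 1) * (- (2 * c + 1 + t) * cf_weight c t) = D t"
      by (simp add: D_def algebra_simps power2_eq_square)
    finally show ?thesis .
  qed
  have "(D has_integral (H 1 - H 0)) {0..1}"
    using D assms unfolding has_real_derivative_iff_has_vector_derivative
    by (intro fundamental_theorem_of_calculus_interior)
      (auto simp: H_def intro!: continuous_intros continuous_on_powr')
  moreover have "(D has_integral (real (m + 1) * cf_moment c m
      - (2 * c + 1) * cf_moment c (m + 1) - real (m + 2) * cf_moment c (m + 2))) {0..1}"
    unfolding D_def
    by (intro has_integral_diff has_integral_mult_right cf_moment_has_integral assms)
  ultimately have "H 1 - H 0 = real (m + 1) * cf_moment c m
      - (2 * c + 1) * cf_moment c (m + 1) - real (m + 2) * cf_moment c (m + 2)"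
    by (rule has_integral_unique)
  then show ?thesis by (simp add: H_def)
qed

text \<open>Up to a constant factor, the two integrands add up to the derivative of
  \<open>((1 - t) / (1 + t)) powr (c + 1)\<close>. The relation makes the alternating series for the
  remainder telescope.\<close>

lemma cf_moment_0_shift:
  assumes "c > 0"
  shows "cf_moment c 0 + cf_moment (c + 1) 0 = 1 / (c + 1)"
proof -
  define H where "H = (\<lambda>t::real. - ((1 - t) powr (c + 1) * (1 + t) powr (- c - 1)) / (c + 1))"
  define D where "D = (\<lambda>t. t ^ 0 * cf_weight c t + t ^ 0 * cf_weight (c + 1) t)"
  have D: "(H has_real_derivative D t) (at t)" if t: "0 < t" "t < 1" for t
  proof -
    have "(H has_real_derivative - (((c + 1) * (1 - t) powr c * (-1)) * (1 + t) powr (- c - 1)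
       + ((- c - 1) * (1 + t) powr (- c - 2)) * (1 - t) powr (c + 1)) / (c + 1)) (at t)"
      unfolding H_def using t assms
      by (auto intro!: derivative_eq_intros)
        (simp only: minus_divide_left minus_diff_eq diff_conv_add_uminus add.commute
          minus_add_distrib minus_minus)
    also have "- (((c + 1) * (1 - t) powr c * (-1)) * (1 + t) powr (- c - 1)
       + ((- c - 1) * (1 + t) powr (- c - 2)) * (1 - t) powr (c + 1)) / (c + 1) = D t"
    proof -
      have "- (((c + 1) * A * (-1)) * B + ((- c - 1) * C) * A') / (c + 1) = A * B + A' * C"
        for A A' B C using assms by (simp add: divide_simps) (simp add: algebra_simps)
      moreover have "- (c + 1) - 1 = - c - 2" by simp
      ultimately show ?thesis by (simp only: D_def cf_weight_def power_0 mult_1_left)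
    qed
    finally show ?thesis .
  qed
  have "(D has_integral (H 1 - H 0)) {0..1}"
    using D assms unfolding has_real_derivative_iff_has_vector_derivative
    by (intro fundamental_theorem_of_calculus_interior)
      (auto simp: H_def intro!: continuous_intros continuous_on_powr')
  moreover have "(D has_integral (cf_moment c 0 + cf_moment (c + 1) 0)) {0..1}"
    unfolding D_def using assms by (intro has_integral_add cf_moment_has_integral) auto
  ultimately have "H 1 - H 0 = cf_moment c 0 + cf_moment (c + 1) 0"
    by (rule has_integral_unique)
  then show ?thesis by (simp add: H_def)
qed

lemma cf_moment_nonneg: "cf_moment c m \<ge> 0"
  unfolding cf_moment_def
  by (cases "(\<lambda>t. t ^ m * cf_weight c t) integrable_on {0..1}")
    (auto intro!: integral_nonneg simp: cf_weight_nonneg not_integrable_integral)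

lemma cf_moment_antimono:
  assumes "c > 0"
  shows "cf_moment c (Suc m) \<le> cf_moment c m"
  by (rule has_integral_le[OF cf_moment_has_integral cf_moment_has_integral])
    (use assms in \<open>auto intro!: mult_right_mono mult_left_le_one_le cf_weight_nonneg\<close>)

text \<open>A zero moment of index \<open>m + 1\<close> forces the next one to vanish by
  monotonicity, and then the recurrence forces the one of index \<open>m\<close> to vanish. A zero
  thus descends to index 0, where \<open>cf_moment_0_1\<close> excludes it.\<close>

lemma cf_moment_pos:
  assumes c: "c > 0"
  shows "cf_moment c m > 0"
proof -
  have "cf_moment c m \<noteq> 0"
  proof (induction m)
    case 0
    show ?case
      using cf_moment_0_1[OF c] cf_moment_nonneg[of c 1] cf_moment_antimono[OF c, of 0] by auto
  next
    case (Suc m)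
    show ?case
    proof
      assume "cf_moment c (Suc m) = 0"
      moreover from this have "cf_moment c (Suc (Suc m)) = 0"
        using cf_moment_nonneg[of c "Suc (Suc m)"] cf_moment_antimono[OF c, of "Suc m"] by auto
      ultimately show False using cf_moment_rec[OF c, of m] Suc by simp
    qed
  qed
  with cf_moment_nonneg[of c m] show ?thesis by simp
qed

section \<open>The remainder of the series as a moment\<close>

lemma cf_moment_0_bounds:
  assumes c: "c > 0"
  shows "1 / (2 * c + 2) \<le> cf_moment c 0" "cf_moment c 0 \<le> 1 / (2 * c + 1)"
  using cf_moment_0_1[OF c] cf_moment_nonneg[of c 1] cf_moment_antimono[OF c, of 0] c
  by (auto simp: field_simps)

text \<open>By \<open>cf_moment_0_shift\<close> the remainder after \<open>N\<close> terms is, up to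
  sign, again a moment of index 0, with parameter \<open>c + real N\<close>; the upper bound sends
  it to 0.\<close>

lemma cf_moment_0_sums:
  assumes c: "c > 0"
  shows "(\<lambda>j. (-1) ^ j / (c + 1 + real j)) sums cf_moment c 0"
proof -
  have part: "(\<Sum>j<N. (-1) ^ j / (c + 1 + real j)) =
      cf_moment c 0 - (-1) ^ N * cf_moment (c + real N) 0" for N
  proof (induction N)
    case (Suc N)
    have "cf_moment (c + real N) 0 + cf_moment (c + real (Suc N)) 0 = 1 / (c + 1 + real N)"
      using cf_moment_0_shift[of "c + real N"] c by (simp add: algebra_simps)
    then have e: "cf_moment (c + real (Suc N)) 0 = 1 / (c + 1 + real N) - cf_moment (c + real N) 0"
      by linarith
    show ?case unfolding sum.lessThan_Suc Suc e by (simp add: right_diff_distrib)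
  qed simp
  have lim: "(\<lambda>N. cf_moment (c + real N) 0) \<longlonglongrightarrow> 0"
  proof (rule tendsto_sandwich)
    show "\<forall>\<^sub>F N in sequentially. cf_moment (c + real N) 0 \<le> 1 / (2 * (c + real N) + 1)"
      using c by (intro always_eventually allI cf_moment_0_bounds(2)) simp
    show "\<forall>\<^sub>F N in sequentially. 0 \<le> cf_moment (c + real N) 0"
      by (intro always_eventually allI cf_moment_nonneg)
    show "(\<lambda>N. 1 / (2 * (c + real N) + 1)) \<longlonglongrightarrow> 0" by real_asymp
  qed auto
  have "(\<lambda>N. (-1) ^ N * cf_moment (c + real N) 0) \<longlonglongrightarrow> 0"
    by (rule tendsto_rabs_zero_cancel)
      (use tendsto_rabs_zero[OF lim] in \<open>simp add: abs_mult\<close>)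
  then have "(\<lambda>N. cf_moment c 0 - (-1) ^ N * cf_moment (c + real N) 0) \<longlonglongrightarrow> cf_moment c 0 - 0"
    by (intro tendsto_intros)
  then show ?thesis by (simp add: sums_def part)
qed

text \<open>Once the first \<open>n + 1\<close> terms are dropped, the denominators are
  \<open>p * (c + 1 + j)\<close>, which is the series of \<open>cf_moment_0_sums\<close> scaled by
  \<open>p\<close>.\<close>

lemma R_rem_eq_cf_moment:
  assumes p: "p > 0" and q: "q > 0"
  shows "R_rem p q n = cf_moment (real n + real q / real p) 0 / real p"
proof -
  define c where "c = real n + real q / real p"
  have c: "c > 0" using p q by (simp add: c_def add_nonneg_pos)
  define f where "f k = (-1) ^ k / (real p * real k + real q)" for k :: nat
  have f: "f (j + Suc n) = (-1) ^ (n + 1) / real p * ((-1) ^ j / (c + 1 + real j))" for j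
  proof -
    have "real p * real (j + Suc n) + real q = real p * (c + 1 + real j)"
      using p by (simp add: c_def distrib_left)
    then show ?thesis
      unfolding f_def by (simp add: power_add)
  qed
  have "(\<lambda>j. f (j + Suc n)) sums ((-1) ^ (n + 1) / real p * cf_moment c 0)"
    unfolding f by (intro sums_mult cf_moment_0_sums c)
  then have "f sums ((-1) ^ (n + 1) / real p * cf_moment c 0 + sum f {..<Suc n})"
    by (simp only: sums_iff_shift diff_add_cancel add_diff_cancel_right')
  then have "S_inf p q = (-1) ^ (n + 1) / real p * cf_moment c 0 + S_part p q n"
    unfolding S_inf_def S_part_def f_def by (simp add: sums_iff lessThan_Suc_atMost atMost_atLeast0)
  then show ?thesis
    unfolding R_rem_def c_def by (simp flip: power_add)
qed

section \<open>Denominators of the convergents and the Casoratian\<close>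

text \<open>If \<open>B\<^sub>m = (2c + 1) B\<^bsub>m-1\<^esub> + m\<^sup>2 B\<^bsub>m-2\<^esub>\<close> are the denominators of the continued fraction, with
  \<open>B\<^bsub>-1\<^esub> = 1\<close> and \<open>B\<^sub>0 = 2c + 1\<close>, then \<open>cf_den c m = B\<^bsub>m-1\<^esub> / m!\<close>.\<close>

fun cf_den :: "real \<Rightarrow> nat \<Rightarrow> real" where
  "cf_den c 0 = 1"
| "cf_den c (Suc 0) = 2 * c + 1"
| "cf_den c (Suc (Suc m)) =
    ((2 * c + 1) * cf_den c (Suc m) + real (m + 1) * cf_den c m) / real (m + 2)"

lemma cf_den_rec:
  "real (m + 2) * cf_den c (m + 2) = (2 * c + 1) * cf_den c (m + 1) + real (m + 1) * cf_den c m"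
  by simp

lemma cf_den_pos:
  assumes "c > 0"
  shows "cf_den c m > 0"
  using assms
proof (induction c m rule: cf_den.induct)
  case (3 c m)
  then show ?case
    unfolding cf_den.simps by (intro divide_pos_pos add_pos_pos mult_pos_pos) auto
qed auto

lemma cf_den_increment:
  assumes c: "c > 0"
  shows "cf_den c m \<le> cf_den c (m + 1)"
    and "real (m + 1) * cf_den c (m + 1) \<le> (real (m + 1) + 2 * c) * cf_den c m"
proof -
  \<comment> \<open>In terms of these weighted increments the recurrence reads
    \<open>E (m + 1) + E m = 2 * c * cf_den c m\<close>. The factor \<open>real m\<close> gives
    \<open>E 0 = 0\<close>, whatever the truncated \<open>m - 1\<close> is.\<close>
  define E where "E m = real m * (cf_den c m - cf_den c (m - 1))" for m
  have sum_E: "E (m + 1) + E m = 2 * c * cf_den c m" for m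
  proof (cases m)
    case (Suc k)
    then show ?thesis
      using cf_den_rec[of k c] by (simp add: E_def algebra_simps del: cf_den.simps)
  qed (simp add: E_def)
  \<comment> \<open>Two consecutive values are carried along: \<open>E (m + 1) \<ge> 0\<close> makes
    the denominators increase at \<open>m\<close>, and the difference of two instances of
    \<open>sum_E\<close> then yields \<open>E m \<le> E (m + 2)\<close>.\<close>
  have "E m \<ge> 0 \<and> E (m + 1) \<ge> 0" for m
  proof (induction m)
    case 0
    then show ?case using c by (simp add: E_def)
  next
    case (Suc m)
    have "cf_den c m \<le> cf_den c (m + 1)"
      using Suc by (simp add: E_def zero_le_mult_iff)
    then have "2 * c * cf_den c m \<le> 2 * c * cf_den c (m + 1)"
      using c by (intro mult_left_mono) auto
    then have "E m \<le> E (m + 2)"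
      using sum_E[of m] sum_E[of "m + 1"] by (simp add: add.commute)
    with Suc show ?case by (simp add: add.commute)
  qed
  then have "E m \<ge> 0" "E (m + 1) \<ge> 0" by auto
  then have "E (m + 1) \<le> 2 * c * cf_den c m" using sum_E[of m] by linarith
  then show "real (m + 1) * cf_den c (m + 1) \<le> (real (m + 1) + 2 * c) * cf_den c m"
    by (simp add: E_def algebra_simps)
  show "cf_den c m \<le> cf_den c (m + 1)"
    using \<open>E (m + 1) \<ge> 0\<close> by (simp add: E_def zero_le_mult_iff)
qed

lemma cf_den_ratio_tendsto:
  assumes c: "c > 0"
  shows "(\<lambda>m. cf_den c m / cf_den c (m + 1)) \<longlonglongrightarrow> 1"
proof (rule tendsto_sandwich)
  show "(\<lambda>m. real (m + 1) / (real (m + 1) + 2 * c)) \<longlonglongrightarrow> 1" by real_asymp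
  show "\<forall>\<^sub>F m in sequentially.
      real (m + 1) / (real (m + 1) + 2 * c) \<le> cf_den c m / cf_den c (m + 1)"
  proof (intro always_eventually allI)
    fix m
    show "real (m + 1) / (real (m + 1) + 2 * c) \<le> cf_den c m / cf_den c (m + 1)"
      using cf_den_increment(2)[OF c, of m] cf_den_pos[OF c, of "m + 1"] c
      by (simp add: divide_simps mult.commute del: cf_den.simps)
  qed
  show "\<forall>\<^sub>F m in sequentially. cf_den c m / cf_den c (m + 1) \<le> 1"
    using cf_den_increment(1)[OF c] cf_den_pos[OF c]
    by (intro always_eventually allI) (simp add: divide_le_eq_1)
qed auto

text \<open>The sign \<open>(-1) ^ m\<close> of the moment solution turns the Casoratian determinant
  into a sum. Inserting both recurrences cancels the terms with \<open>2 * c + 1\<close> and leads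
  back to the previous index.\<close>

lemma cf_casoratian:
  assumes c: "c > 0"
  shows "real (m + 1) * (cf_den c (m + 1) * cf_moment c m + cf_den c m * cf_moment c (m + 1)) = 1"
proof (induction m)
  case 0
  then show ?case using cf_moment_0_1[OF c] by simp
next
  case (Suc m)
  have "real (m + 2) * (cf_den c (m + 2) * cf_moment c (m + 1) + cf_den c (m + 1) * cf_moment c (m + 2))
    = (real (m + 2) * cf_den c (m + 2)) * cf_moment c (m + 1)
      + cf_den c (m + 1) * (real (m + 2) * cf_moment c (m + 2))"
    by (simp add: algebra_simps del: cf_den.simps)
  also have "real (m + 2) * cf_moment c (m + 2) =
      real (m + 1) * cf_moment c m - (2 * c + 1) * cf_moment c (m + 1)"
    using cf_moment_rec[OF c, of m] by linarith
  also note cf_den_rec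
  also have "((2 * c + 1) * cf_den c (m + 1) + real (m + 1) * cf_den c m) * cf_moment c (m + 1) +
      cf_den c (m + 1) * (real (m + 1) * cf_moment c m - (2 * c + 1) * cf_moment c (m + 1)) =
      real (m + 1) * (cf_den c (m + 1) * cf_moment c m + cf_den c m * cf_moment c (m + 1))"
    by (simp add: algebra_simps del: cf_den.simps)
  also note Suc
  finally show ?case by (simp add: add.commute del: cf_den.simps)
qed

section \<open>Exact error of the convergents\<close>

text \<open>The tail \<open>y\<close> is kept free for the induction. The natural coefficients \<open>m I\<^bsub>m-1\<^esub>\<close> and
  \<open>m b\<^bsub>m-1\<^esub>\<close> would be wrong at \<open>m = 0\<close> (both should be 1 there), so they are written out by means of
  the recurrences. At \<open>y = 2c + 1\<close> the terms in \<open>I\<^sub>m\<close> and \<open>b\<^sub>m\<close> drop out.\<close>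

lemma cf_tail_eq:
  fixes c p y :: real
  assumes c: "c > 0" and p: "p > 0" and y: "y > 0"
  shows "1 / foldr (\<lambda>k t. p * (2 * c + 1) + (real k * p)\<^sup>2 / t) [1..<Suc m] (p * y) =
    1 / p * (cf_moment c 0 + (-1) ^ m *
      (real (m + 1) * cf_moment c (m + 1) - (y - (2 * c + 1)) * cf_moment c m) /
      ((y - (2 * c + 1)) * cf_den c m + real (m + 1) * cf_den c (m + 1)))"
  using y
proof (induction m arbitrary: y)
  case 0
  have "cf_moment c 1 = 1 - (2 * c + 1) * cf_moment c 0"
    using cf_moment_0_1[OF c] by linarith
  with 0 p show ?case by (simp add: field_simps)
next
  case (Suc m)
  \<comment> \<open>The innermost level, numbered \<open>Suc m\<close>, is absorbed into the tail:
    \<open>p * y\<close> becomes \<open>p * y'\<close> and the list loses its last entry.\<close>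
  define y' where "y' = 2 * c + 1 + (real (m + 1))\<^sup>2 / y"
  have y': "y' > 0" using c Suc.prems by (auto simp: y'_def intro!: add_pos_nonneg)
  \<comment> \<open>Numerator and denominator both acquire the factor \<open>(m + 1) / y\<close>,
    which cancels; the minus sign in the numerator raises the power of -1.\<close>
  have num: "real (m + 1) * cf_moment c (m + 1) - (y' - (2 * c + 1)) * cf_moment c m =
      - real (m + 1) / y * (real (m + 2) * cf_moment c (m + 2) - (y - (2 * c + 1)) * cf_moment c (m + 1))"
  proof -
    have e: "real (m + 2) * cf_moment c (m + 2) =
      real (m + 1) * cf_moment c m - (2 * c + 1) * cf_moment c (m + 1)"
      using cf_moment_rec[OF c, of m] by linarith
    show ?thesis unfolding e using Suc.prems by (simp add: y'_def field_simps power2_eq_square)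
  qed
  have den: "(y' - (2 * c + 1)) * cf_den c m + real (m + 1) * cf_den c (m + 1) =
      real (m + 1) / y * ((y - (2 * c + 1)) * cf_den c (m + 1) + real (m + 2) * cf_den c (m + 2))"
    unfolding cf_den_rec using Suc.prems
    by (simp add: y'_def field_simps power2_eq_square del: cf_den.simps)
  have "p * (2 * c + 1) + (real (Suc m) * p)\<^sup>2 / (p * y) = p * y'"
    using p Suc.prems by (simp add: y'_def field_simps power2_eq_square)
  then have "1 / foldr (\<lambda>k t. p * (2 * c + 1) + (real k * p)\<^sup>2 / t) [1..<Suc (Suc m)] (p * y) =
     1 / foldr (\<lambda>k t. p * (2 * c + 1) + (real k * p)\<^sup>2 / t) [1..<Suc m] (p * y')"
    by simp
  also note Suc.IH[OF y']
  also note num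
  also note den
  also have "(-1) ^ m * (- real (m + 1) / y * N) / (real (m + 1) / y * D) = (-1) ^ Suc m * N / D" for N D
  proof -
    have "(-1) ^ m * (- real (m + 1) / y * N) / (real (m + 1) / y * D) =
      (real (m + 1) / y * ((-1) ^ Suc m * N)) / (real (m + 1) / y * D)"
      by (simp only: power_Suc minus_divide_left[symmetric] mult_minus_left mult_minus_right mult_1_left mult_ac)
    also have "\<dots> = (-1) ^ Suc m * N / D"
      by (rule mult_divide_mult_cancel_left) (use Suc.prems in simp)
    finally show ?thesis .
  qed
  finally show ?case by (simp only: Suc_eq_plus1 add.assoc one_add_one)
qed

text \<open>The tail is taken as \<open>y = 2 * c + 1\<close>, because \<open>alpha p q n\<close> is
  \<open>p * (2 * c + 1)\<close>; the common factor \<open>m + 1\<close> then cancels.\<close>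

lemma rho_minus_R_rem:
  fixes p q n :: nat
  defines "c \<equiv> real n + real q / real p"
  assumes p: "p > 0" and q: "q > 0"
  shows "rho p q n m - R_rem p q n =
    (-1) ^ m * (cf_moment c (m + 1) / cf_den c (m + 1)) / real p"
proof -
  have c: "c > 0" using p q by (simp add: c_def add_nonneg_pos)
  have al: "alpha p q n = real p * (2 * c + 1)"
    using p by (simp add: alpha_def c_def field_simps)
  have "rho p q n m = 1 / real p * (cf_moment c 0 + (-1) ^ m *
      (real (m + 1) * cf_moment c (m + 1)) / (real (m + 1) * cf_den c (m + 1)))"
    unfolding rho_def al using cf_tail_eq[OF c, of "real p" "2 * c + 1" m] p c by simp
  also have "\<dots> = R_rem p q n + (-1) ^ m * (cf_moment c (m + 1) / cf_den c (m + 1)) / real p"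
    unfolding R_rem_eq_cf_moment[OF p q] c_def[symmetric]
    by (simp add: distrib_left mult_ac del: of_nat_Suc cf_den.simps)
  finally show ?thesis by simp
qed

section \<open>Asymptotics of the moments by comparison with Beta integrals\<close>

text \<open>This is Euler's limit for the Gamma function, with the Pochhammer symbol written as a
  quotient of Gamma values.\<close>

lemma Beta_integral_asymp:
  assumes c: "c > 0"
  shows "(\<lambda>m. Beta (real m + 1) c * real m powr c) \<longlonglongrightarrow> Gamma c"
proof (rule Lim_transform_eventually[OF Gamma_series_LIMSEQ])
  show "\<forall>\<^sub>F m in sequentially. Gamma_series c m = Beta (real m + 1) c * real m powr c"
    using eventually_gt_at_top[of 0]
  proof eventually_elim
    case (elim m)
    have "pochhammer c (m + 1) = Gamma (c + real (m + 1)) / Gamma c"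
      by (rule pochhammer_Gamma) (use c in \<open>auto elim!: nonpos_Ints_cases\<close>)
    moreover have "Gamma (real m + 1) = fact m"
      using Gamma_fact[of m, where 'a = real] by (simp add: add.commute)
    moreover have "Gamma c > 0" "Gamma (c + real (m + 1)) > 0"
      using c by (auto intro!: Gamma_real_pos)
    ultimately show ?case
      using elim unfolding Gamma_series_def Beta_def
      by (simp add: powr_def exp_of_real add_ac)
  qed
qed

text \<open>With \<open>m > 0\<close> the integrand agrees with its \<open>powr\<close> form also at
  \<open>t = 0\<close>, where \<open>0 ^ 0 = 1\<close> would differ from
  \<open>0 powr 0 = 0\<close>.\<close>

lemma has_integral_power_Beta:
  assumes "m > 0" "c > 0"
  shows "((\<lambda>t. t ^ m * (1 - t) powr c) has_integral Beta (real m + 1) (c + 1)) {0..1}"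
proof (rule has_integral_eq)
  show "((\<lambda>t. t powr (real m + 1 - 1) * (1 - t) powr (c + 1 - 1)) has_integral
      Beta (real m + 1) (c + 1)) {0..1}"
    using assms by (intro has_integral_Beta_real) auto
qed (use assms in \<open>auto simp: powr_realpow'\<close>)

text \<open>The upper bound is the mean value theorem between \<open>1 + t\<close> and 2, where the
  derivative of \<open>x powr (- c - 1)\<close> is at most \<open>c + 1\<close> in absolute
  value.\<close>

lemma powr_chord_bounds:
  fixes c t :: real
  assumes c: "c > 0" and t: "0 \<le> t" "t \<le> 1"
  shows "2 powr (- c - 1) \<le> (1 + t) powr (- c - 1)"
    and "(1 + t) powr (- c - 1) \<le> 2 powr (- c - 1) + (c + 1) * (1 - t)"
proof -
  show "2 powr (- c - 1) \<le> (1 + t) powr (- c - 1)"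
    using assms by (intro powr_mono2') auto
  show "(1 + t) powr (- c - 1) \<le> 2 powr (- c - 1) + (c + 1) * (1 - t)"
  proof (cases "t = 1")
    case False
    then have "\<exists>z. 1 + t < z \<and> z < 2 \<and> 2 powr (- c - 1) - (1 + t) powr (- c - 1) =
        (2 - (1 + t)) * ((- c - 1) * z powr (- c - 1 - 1))"
      using t by (intro MVT2 has_real_derivative_powr) auto
    then obtain z where z: "1 + t < z" "2 powr (- c - 1) - (1 + t) powr (- c - 1) =
        (2 - (1 + t)) * ((- c - 1) * z powr (- c - 1 - 1))" by blast
    have "z powr (- c - 1 - 1) \<le> z powr 0"
      using z t c by (intro powr_mono) auto
    then have "(1 - t) * (c + 1) * z powr (- c - 1 - 1) \<le> (1 - t) * (c + 1) * 1"
      using z t c by (intro mult_left_mono) auto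
    with z show ?thesis by (simp add: algebra_simps)
  qed auto
qed

text \<open>The mass of \<open>t ^ m\<close> concentrates at \<open>t = 1\<close>, where the factor
  \<open>(1 + t) powr (- c - 1)\<close> is \<open>2 powr (- c - 1)\<close>. The error term in
  \<open>1 - t\<close> raises the second Beta parameter by one and so gains a factor of order
  \<open>1 / m\<close>.\<close>

lemma cf_moment_asymp:
  assumes c: "c > 0"
  shows "(\<lambda>m. cf_moment c m * real m powr (c + 1)) \<longlonglongrightarrow> 2 powr (- c - 1) * Gamma (c + 1)"
proof (rule tendsto_sandwich)
  let ?B = "\<lambda>m. Beta (real m + 1) (c + 1)" and ?B' = "\<lambda>m. Beta (real m + 1) (c + 1 + 1)"
  have lim: "(\<lambda>m. ?B m * real m powr (c + 1)) \<longlonglongrightarrow> Gamma (c + 1)"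
    "(\<lambda>m. ?B' m * real m powr (c + 1 + 1)) \<longlonglongrightarrow> Gamma (c + 1 + 1)"
    using c by (intro Beta_integral_asymp; simp)+
  show "(\<lambda>m. 2 powr (- c - 1) * (?B m * real m powr (c + 1))) \<longlonglongrightarrow> 2 powr (- c - 1) * Gamma (c + 1)"
    by (intro tendsto_intros lim)
  have "(\<lambda>m. 2 powr (- c - 1) * (?B m * real m powr (c + 1)) +
      (c + 1) * ((?B' m * real m powr (c + 1 + 1)) * (1 / real m)))
    \<longlonglongrightarrow> 2 powr (- c - 1) * Gamma (c + 1) + (c + 1) * (Gamma (c + 1 + 1) * 0)"
    by (intro tendsto_intros lim lim_const_over_n)
  then show "(\<lambda>m. 2 powr (- c - 1) * (?B m * real m powr (c + 1)) +
      (c + 1) * ((?B' m * real m powr (c + 1 + 1)) * (1 / real m))) \<longlonglongrightarrow> 2 powr (- c - 1) * Gamma (c + 1)"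
    by simp
  show "\<forall>\<^sub>F m in sequentially. 2 powr (- c - 1) * (?B m * real m powr (c + 1))
      \<le> cf_moment c m * real m powr (c + 1)"
    using eventually_gt_at_top[of 0]
  proof eventually_elim
    case (elim m)
    have "2 powr (- c - 1) * ?B m \<le> cf_moment c m"
    proof (rule has_integral_le)
      show "((\<lambda>t. 2 powr (- c - 1) * (t ^ m * (1 - t) powr c)) has_integral
          2 powr (- c - 1) * ?B m) {0..1}"
        by (intro has_integral_mult_right has_integral_power_Beta elim c)
      fix t :: real assume t: "t \<in> {0..1}"
      then have "(t ^ m * (1 - t) powr c) * 2 powr (- c - 1) \<le>
          (t ^ m * (1 - t) powr c) * (1 + t) powr (- c - 1)"
        by (intro mult_left_mono powr_chord_bounds(1) c) auto
      then show "2 powr (- c - 1) * (t ^ m * (1 - t) powr c) \<le> t ^ m * cf_weight c t"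
        by (simp add: cf_weight_def mult_ac)
    qed (rule cf_moment_has_integral[OF c])
    then have "2 powr (- c - 1) * ?B m * real m powr (c + 1) \<le> cf_moment c m * real m powr (c + 1)"
      by (intro mult_right_mono) auto
    then show ?case by (simp add: mult_ac)
  qed
  show "\<forall>\<^sub>F m in sequentially. cf_moment c m * real m powr (c + 1) \<le>
      2 powr (- c - 1) * (?B m * real m powr (c + 1)) +
      (c + 1) * ((?B' m * real m powr (c + 1 + 1)) * (1 / real m))"
    using eventually_gt_at_top[of 0]
  proof eventually_elim
    case (elim m)
    have "cf_moment c m \<le> 2 powr (- c - 1) * ?B m + (c + 1) * ?B' m"
    proof (rule has_integral_le)
      show "((\<lambda>t. 2 powr (- c - 1) * (t ^ m * (1 - t) powr c) +
          (c + 1) * (t ^ m * (1 - t) powr (c + 1))) has_integral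
          2 powr (- c - 1) * ?B m + (c + 1) * ?B' m) {0..1}"
        using elim c by (intro has_integral_add has_integral_mult_right has_integral_power_Beta) auto
      fix t :: real assume t: "t \<in> {0..1}"
      then have "(t ^ m * (1 - t) powr c) * (1 + t) powr (- c - 1) \<le>
          (t ^ m * (1 - t) powr c) * (2 powr (- c - 1) + (c + 1) * (1 - t))"
        by (intro mult_left_mono powr_chord_bounds(2) c) auto
      moreover have "(1 - t) powr (c + 1) = (1 - t) powr c * (1 - t)"
        using t by (cases "t = 1") (auto simp: powr_add)
      ultimately show "t ^ m * cf_weight c t \<le> 2 powr (- c - 1) * (t ^ m * (1 - t) powr c) +
          (c + 1) * (t ^ m * (1 - t) powr (c + 1))"
        by (simp only: cf_weight_def) (simp add: algebra_simps)
    qed (rule cf_moment_has_integral[OF c])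
    then have "cf_moment c m * real m powr (c + 1) \<le>
        (2 powr (- c - 1) * ?B m + (c + 1) * ?B' m) * real m powr (c + 1)"
      by (intro mult_right_mono) auto
    moreover have "real m powr (c + 1 + 1) * (1 / real m) = real m powr (c + 1)"
      by (subst powr_add) (use elim in simp)
    ultimately have "cf_moment c m * real m powr (c + 1) \<le>
        2 powr (- c - 1) * (?B m * real m powr (c + 1)) +
        (c + 1) * (?B' m * (real m powr (c + 1 + 1) * (1 / real m)))"
      by (simp only: distrib_right mult.assoc)
    then show ?case by (simp only: mult.assoc)
  qed
qed

section \<open>Asymptotics of the error\<close>

lemma cf_moment_ratio_tendsto:
  assumes c: "c > 0"
  shows "(\<lambda>m. cf_moment c m / cf_moment c (m + 1)) \<longlonglongrightarrow> 1"
proof -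
  define f where "f m = cf_moment c m * real m powr (c + 1)" for m
  define L where "L = 2 powr (- c - 1) * Gamma (c + 1)"
  have L: "L > 0" using c by (auto simp: L_def intro!: mult_pos_pos Gamma_real_pos)
  have f: "f \<longlonglongrightarrow> L" unfolding f_def L_def by (rule cf_moment_asymp[OF c])
  have "(\<lambda>m. f m / f (m + 1) * ((real m + 1) / real m) powr (c + 1)) \<longlonglongrightarrow> L / L * 1"
    using L c by (intro tendsto_mult tendsto_divide f LIMSEQ_ignore_initial_segment) (auto, real_asymp)
  moreover have "\<forall>\<^sub>F m in sequentially. f m / f (m + 1) * ((real m + 1) / real m) powr (c + 1) =
      cf_moment c m / cf_moment c (m + 1)"
    using eventually_gt_at_top[of 0]
    by eventually_elim (simp add: f_def powr_divide add.commute)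
  ultimately show ?thesis using L by (simp add: tendsto_cong)
qed

text \<open>The Casoratian identity rewrites
  \<open>I\<^sub>m\<^sub>+\<^sub>1 / b\<^sub>m\<^sub>+\<^sub>1\<close> as
  \<open>(m + 1) * (I\<^sub>m\<^sub>+\<^sub>1)\<^sup>2 * h m\<close>, where \<open>h m\<close> tends
  to 2. Thus only the ratios of the denominators enter, not their growth.\<close>

lemma cf_error_asymp:
  assumes c: "c > 0"
  shows "(\<lambda>m. cf_moment c (m + 1) / cf_den c (m + 1) * real m powr (2 * c + 1)) \<longlonglongrightarrow>
    2 * (2 powr (- c - 1) * Gamma (c + 1))\<^sup>2"
proof -
  define L where "L = 2 powr (- c - 1) * Gamma (c + 1)"
  define f where "f m = cf_moment c m * real m powr (c + 1)" for m
  define h where "h m = cf_moment c m / cf_moment c (m + 1) + cf_den c m / cf_den c (m + 1)" for m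
  have f: "f \<longlonglongrightarrow> L" unfolding f_def L_def by (rule cf_moment_asymp[OF c])
  have h: "h \<longlonglongrightarrow> 1 + 1"
    unfolding h_def by (intro tendsto_add cf_moment_ratio_tendsto cf_den_ratio_tendsto c)
  have "(\<lambda>m. (f (m + 1))\<^sup>2 * h m * (real m / (real m + 1)) powr (2 * c + 1)) \<longlonglongrightarrow> L\<^sup>2 * (1 + 1) * 1"
    using c by (intro tendsto_mult tendsto_power f h LIMSEQ_ignore_initial_segment) real_asymp
  moreover have "(f (m + 1))\<^sup>2 * h m * (real m / (real m + 1)) powr (2 * c + 1) =
      cf_moment c (m + 1) / cf_den c (m + 1) * real m powr (2 * c + 1)" for m
  proof -
    define x where "x = real m + 1"
    define I I' b b' where "I = cf_moment c m" "I' = cf_moment c (m + 1)"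
      "b = cf_den c m" "b' = cf_den c (m + 1)"
    note defs = this
    have pos: "x > 0" "I' > 0" "b' > 0"
      unfolding defs x_def using cf_moment_pos[OF c] cf_den_pos[OF c] by auto
    have cas: "x * (b' * I + b * I') = 1"
      using cf_casoratian[OF c, of m] by (simp add: x_def defs add.commute del: cf_den.simps)
    have "(x powr (c + 1))\<^sup>2 = x powr ((2 * c + 1) + 1)"
      by (simp add: power2_eq_square add.commute flip: powr_add)
    also have "\<dots> = x powr (2 * c + 1) * x"
      by (subst powr_add) (use pos in simp)
    finally have "(I' * x powr (c + 1))\<^sup>2 * (I / I' + b / b') * (real m / x) powr (2 * c + 1) =
      I'\<^sup>2 * x * (I / I' + b / b') * real m powr (2 * c + 1)"
      using pos by (simp add: powr_divide power_mult_distrib)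
    also have "I'\<^sup>2 * x * (I / I' + b / b') = I' / b' * (x * (b' * I + b * I'))"
      using pos by (simp add: field_simps power2_eq_square)
    also note cas
    finally show ?thesis by (simp add: f_def h_def defs x_def add.commute del: cf_den.simps)
  qed
  ultimately show ?thesis by (simp add: L_def mult.commute)
qed

section \<open>Rate of convergence and comparison with the partial sums\<close>

theorem mainTheorem3:
  fixes p q n :: nat
  assumes "p > 0" and "q > 0"
  shows "converges_infra_linearly (v_seq p q n) (S_inf p q) \<and>
         converges_faster (v_seq p q n) (S_part p q) (S_inf p q) \<and>
         (\<exists>\<omega>>0.
            (\<forall>m. \<bar>v_seq p q n m - S_inf p q\<bar> = \<bar>rho p q n m - R_rem p q n\<bar>) \<and>
            (\<lambda>m. \<bar>rho p q n m - R_rem p q n\<bar>) \<sim>[sequentially]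
            (\<lambda>m. \<omega> / real m powr (2 * real n + 1 + 2 * real q / real p)))"
proof -
  define c where "c = real n + real q / real p"
  have c: "c > 0" using assms by (simp add: c_def add_nonneg_pos)
  define \<omega> where "\<omega> = 2 * (2 powr (- c - 1) * Gamma (c + 1))\<^sup>2 / real p"
  have \<omega>: "\<omega> > 0"
    unfolding \<omega>_def using c assms
    by (intro divide_pos_pos mult_pos_pos zero_less_power Gamma_real_pos) auto
  define e where "e m = \<bar>v_seq p q n m - S_inf p q\<bar>" for m
  \<comment> \<open>The rescaled error tends to \<open>\<omega> > 0\<close>, and the claims on
    \<open>v_seq\<close> are read off from this limit.\<close>
  define g where "g = (\<lambda>m. e m * real m powr (2 * c + 1))"
  have e_rho: "e m = \<bar>rho p q n m - R_rem p q n\<bar>" for m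
    unfolding e_def v_seq_def S_inf_eq[of p q n]
    by (simp add: abs_mult flip: right_diff_distrib)
  have e: "e m = cf_moment c (m + 1) / cf_den c (m + 1) / real p" for m
    unfolding e_rho rho_minus_R_rem[OF assms] c_def[symmetric]
    using cf_moment_pos[OF c, of "m + 1"] cf_den_pos[OF c, of "m + 1"]
    by (simp add: abs_mult del: cf_den.simps)
  have e_pos: "e m > 0" for m
    unfolding e using assms cf_moment_pos[OF c] cf_den_pos[OF c] by simp
  have g: "g \<longlonglongrightarrow> \<omega>"
    using tendsto_divide[OF cf_error_asymp[OF c] tendsto_const[of "real p"]] assms
    by (simp add: g_def e \<omega>_def del: cf_den.simps)
  \<comment> \<open>At \<open>m = 0\<close> the right side would be 0, since
    \<open>0 powr x = 0\<close>, while \<open>e 0 > 0\<close>.\<close>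
  have e_g: "e m = g m * real m powr (- (2 * c + 1))" if "m > 0" for m
  proof -
    have "real m powr (2 * c + 1) * real m powr (- (2 * c + 1)) = 1"
      using that by (simp flip: powr_add)
    then show ?thesis by (simp only: g_def mult.assoc mult_1_right)
  qed

  \<comment> \<open>The exponent \<open>2 * c + 1\<close> exceeds 1, so the error is still
    negligible after multiplication by \<open>m\<close>; this beats the partial sums, whose error
    has order \<open>1 / m\<close>.\<close>
  have e_faster: "(\<lambda>m. e m * real m) \<longlonglongrightarrow> 0" "e \<longlonglongrightarrow> 0"
  proof -
    have "(\<lambda>m. g m * (real m powr (- (2 * c + 1)) * real m)) \<longlonglongrightarrow> \<omega> * 0"
      using c by (intro tendsto_mult g) real_asymp
    moreover have "\<forall>\<^sub>F m in sequentially. g m * (real m powr (- (2 * c + 1)) * real m) = e m * real m"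
      using eventually_gt_at_top[of 0] by eventually_elim (simp add: e_g)
    ultimately have "(\<lambda>m. e m * real m) \<longlonglongrightarrow> \<omega> * 0"
      by (rule Lim_transform_eventually)
    then show "(\<lambda>m. e m * real m) \<longlonglongrightarrow> 0" by simp
    have "(\<lambda>m. g m * real m powr (- (2 * c + 1))) \<longlonglongrightarrow> \<omega> * 0"
      using c by (intro tendsto_mult g) real_asymp
    moreover have "\<forall>\<^sub>F m in sequentially. g m * real m powr (- (2 * c + 1)) = e m"
      using eventually_gt_at_top[of 0] by eventually_elim (simp add: e_g)
    ultimately have "e \<longlonglongrightarrow> \<omega> * 0"
      by (rule Lim_transform_eventually)
    then show "e \<longlonglongrightarrow> 0" by simp
  qed
  have v_lim: "v_seq p q n \<longlonglongrightarrow> S_inf p q"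
    by (rule LIM_zero_cancel, rule tendsto_rabs_zero_cancel)
      (use e_faster(2) in \<open>simp flip: e_def\<close>)

  have "(\<lambda>m. g (Suc m) / g m * (real m / (real m + 1)) powr (2 * c + 1)) \<longlonglongrightarrow> \<omega> / \<omega> * 1"
    using \<omega> c by (intro tendsto_mult tendsto_divide g LIMSEQ_Suc) (auto, real_asymp)
  moreover have "\<forall>\<^sub>F m in sequentially. g (Suc m) / g m * (real m / (real m + 1)) powr (2 * c + 1) =
      \<bar>(v_seq p q n (Suc m) - S_inf p q) / (v_seq p q n m - S_inf p q)\<bar>"
    using eventually_gt_at_top[of 0]
    by eventually_elim (simp add: g_def powr_divide e_def add.commute)
  ultimately have "(\<lambda>m. \<bar>(v_seq p q n (Suc m) - S_inf p q) / (v_seq p q n m - S_inf p q)\<bar>)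
      \<longlonglongrightarrow> \<omega> / \<omega> * 1"
    by (rule Lim_transform_eventually)
  then have ratio:
      "(\<lambda>m. \<bar>(v_seq p q n (Suc m) - S_inf p q) / (v_seq p q n m - S_inf p q)\<bar>) \<longlonglongrightarrow> 1"
    using \<omega> by simp
  have v_ne: "v_seq p q n m \<noteq> S_inf p q" for m
    using e_pos[of m] by (simp add: e_def)

  define d where "d = real q / real p"
  have d: "d > 0" using assms by (simp add: d_def)
  \<comment> \<open>The error of the partial sum is the remainder at \<open>n = m\<close>, so here
    the parameter of the moment grows and its index stays 0.\<close>
  have S_err: "\<bar>S_part p q m - S_inf p q\<bar> = cf_moment (real m + d) 0 / real p" for m
  proof -
    have "\<bar>S_part p q m - S_inf p q\<bar> = \<bar>R_rem p q m\<bar>"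
      unfolding S_inf_eq[of p q m] by (simp add: abs_mult)
    then show ?thesis
      using cf_moment_nonneg by (simp add: R_rem_eq_cf_moment[OF assms] d_def)
  qed
  have S_lower: "1 / (real p * (2 * (real m + d) + 2)) \<le> \<bar>S_part p q m - S_inf p q\<bar>" for m
    using divide_right_mono[OF cf_moment_0_bounds(1)[of "real m + d"], of "real p"] d
    by (simp add: S_err add_nonneg_pos mult.commute[of "real p"])
  have S_upper: "\<bar>S_part p q m - S_inf p q\<bar> \<le> 1 / (real p * (2 * (real m + d) + 1))" for m
    using divide_right_mono[OF cf_moment_0_bounds(2)[of "real m + d"], of "real p"] d
    by (simp add: S_err add_nonneg_pos mult.commute[of "real p"])
  have S_pos: "0 < 1 / (real p * (2 * (real m + d) + 2))" for m
    using d assms by (intro divide_pos_pos mult_pos_pos) auto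
  have S_ne: "S_part p q m \<noteq> S_inf p q" for m
    using S_lower[of m] S_pos[of m] by auto
  have p: "real p > 0" using assms by simp
  have "(\<lambda>m. \<bar>S_part p q m - S_inf p q\<bar>) \<longlonglongrightarrow> 0"
  proof (rule tendsto_sandwich[OF always_eventually always_eventually tendsto_const])
    show "(\<lambda>m. 1 / (real p * (2 * (real m + d) + 1))) \<longlonglongrightarrow> 0" using p by real_asymp
  qed (use S_upper in auto)
  then have S_lim: "S_part p q \<longlonglongrightarrow> S_inf p q"
    by (rule LIM_zero_cancel[OF tendsto_rabs_zero_cancel])
  \<comment> \<open>The lower bound \<open>S_lower\<close> replaces the division by multiplication
    with a linear function of \<open>m\<close>, and both parts of \<open>e_faster\<close>
    apply.\<close>
  have faster: "(\<lambda>m. \<bar>(v_seq p q n m - S_inf p q) / (S_part p q m - S_inf p q)\<bar>) \<longlonglongrightarrow> 0"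
  proof (rule tendsto_sandwich[OF always_eventually always_eventually tendsto_const])
    have "(\<lambda>m. 2 * real p * (e m * real m) + real p * (2 * d + 2) * e m) \<longlonglongrightarrow>
        2 * real p * 0 + real p * (2 * d + 2) * 0"
      by (intro tendsto_intros e_faster)
    then show "(\<lambda>m. e m * (real p * (2 * (real m + d) + 2))) \<longlonglongrightarrow> 0"
      by (simp add: algebra_simps)
    show "\<forall>m. \<bar>(v_seq p q n m - S_inf p q) / (S_part p q m - S_inf p q)\<bar>
        \<le> e m * (real p * (2 * (real m + d) + 2))"
    proof
      fix m
      have "e m / \<bar>S_part p q m - S_inf p q\<bar> \<le> e m / (1 / (real p * (2 * (real m + d) + 2)))"
        by (rule divide_left_mono[OF S_lower less_imp_le[OF e_pos]
              mult_pos_pos[OF less_le_trans[OF S_pos S_lower] S_pos]])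
      then show "\<bar>(v_seq p q n m - S_inf p q) / (S_part p q m - S_inf p q)\<bar>
        \<le> e m * (real p * (2 * (real m + d) + 2))"
        by (simp add: e_def)
    qed
  qed auto

  have equiv: "e \<sim>[sequentially] (\<lambda>m. \<omega> / real m powr (2 * c + 1))"
  proof (rule asymp_equivI')
    have "(\<lambda>m. g m / \<omega>) \<longlonglongrightarrow> \<omega> / \<omega>" using \<omega> by (intro tendsto_divide g) auto
    then show "(\<lambda>m. e m / (\<omega> / real m powr (2 * c + 1))) \<longlonglongrightarrow> 1"
      using \<omega> by (simp add: g_def)
  qed
  have exponent: "2 * real n + 1 + 2 * real q / real p = 2 * c + 1"
    by (simp add: c_def algebra_simps)
  have err: "\<forall>m. \<bar>v_seq p q n m - S_inf p q\<bar> = \<bar>rho p q n m - R_rem p q n\<bar>"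
    unfolding e_def[symmetric] e_rho by simp
  have "converges_infra_linearly (v_seq p q n) (S_inf p q)"
    unfolding converges_infra_linearly_def by (intro conjI allI v_lim v_ne ratio)
  moreover have "converges_faster (v_seq p q n) (S_part p q) (S_inf p q)"
    unfolding converges_faster_def by (intro conjI allI v_lim S_lim S_ne faster)
  ultimately show ?thesis
    unfolding exponent e_rho[symmetric]
    by (intro conjI exI[of _ \<omega>] \<omega> err[unfolded e_rho[symmetric]] equiv)
qed

end
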